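(* There exists an absolute constant $c>0$ such that the following holds. Let $N,M,T$ be positive integers with $N\ge MT$. Let $\delta\in(0,1)$ and $\alpha>1$ be real numbers with $\alpha<\delta^3 e^{T/32}/128$. Let $\mathcal{H}$ be any family of hash functions $[N]\to[M]$ and $H$ a uniformly random member of $\mathcal{H}$. Then there exist an integer $K\ge c\,\delta^2MT/\log(\alpha/\delta)$ and a block $K$-source $\mathbf{X}=(X_1,\dots,X_T)$ over $[N]^T$ (independent of $H$) such that $(H,\mathbf{Y})=(H,H(X_1),\dots,H(X_T))$ is $(1-\delta)$-far in statistical distance from every distribution $(H',\mathbf{Z})$ on $\mathcal{H}\times[M]^T$ with $\mathrm{cp}(H',\mathbf{Z})\le\alpha/(|\mathcal{H}|\cdot M^T)$.
   Context: $[n]=\{1,\dots,n\}$. A hash family is a multiset of functions $[N]\to[M]$. $\mathrm{cp}(X)=\sum_x\Pr[X=x]^2$. A sequence $(X_1,\dots,X_T)$ over $[N]^T$ is a block $K$-source if for every $i$ and every $x_{<i}$ in the support of $(X_1,\dots,X_{i-1})$, $\mathrm{cp}(X_i\mid X_{<i}=x_{<i})\le 1/K$. Statistical distance: $\Delta(X,Y)=\max_S|\Pr[X\in S]-\Pr[Y\in S]|$; $X$ is $\varepsilon$-far from $Y$ if $\Delta(X,Y)\ge\varepsilon$.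
   Formalization: Proved for M ≥ 2 and with log(α/δ) read as max(1, ln(α/δ)): for M = 1, Y is constant and the claim fails; as α/δ → 1 with N = MT the literal bound forces K > N, which no block K-source over [N]^T allows. *)

theory Defs
  imports "HOL-Probability.Probability" "HOL-Library.Multiset"
begin

text \<open>
  A random variable enters only through its distribution, a \<open>pmf\<close>.  The sum below is over
  the whole type, so that it is the genuine collision probability of every \<open>pmf\<close>, finitely
  supported or not.
\<close>

definition cp :: "'a pmf \<Rightarrow> real" where
  "cp p = (\<Sum>\<^sub>\<infinity>x. (pmf p x)\<^sup>2)"

definition stat_dist :: "'a pmf \<Rightarrow> 'a pmf \<Rightarrow> real" where
  "stat_dist p q = (SUP S. \<bar>measure_pmf.prob p S - measure_pmf.prob q S\<bar>)"

definition far :: "real \<Rightarrow> 'a pmf \<Rightarrow> 'a pmf \<Rightarrow> bool" where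
  "far \<epsilon> p q \<longleftrightarrow> stat_dist p q \<ge> \<epsilon>"

definition tuples :: "nat \<Rightarrow> nat \<Rightarrow> nat list set" where
  "tuples n T = {xs. length xs = T \<and> set xs \<subseteq> {1..n}}"

text \<open>
  Positions are counted from \<open>0\<close>: the block \<open>xs ! i\<close> is preceded by \<open>take i xs\<close>.  The
  conditioning event has positive probability because \<open>p\<close> lies in the support of the prefix.
\<close>

definition block_source :: "nat \<Rightarrow> nat \<Rightarrow> nat \<Rightarrow> nat list pmf \<Rightarrow> bool" where
  "block_source K N T X \<longleftrightarrow>
     set_pmf X \<subseteq> tuples N T \<and>
     (\<forall>i<T. \<forall>p \<in> set_pmf (map_pmf (take i) X).
        cp (map_pmf (\<lambda>xs. xs ! i) (cond_pmf X {xs. take i xs = p})) \<le> 1 / real K)"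

definition hash_family :: "nat \<Rightarrow> nat \<Rightarrow> (nat \<Rightarrow> nat) multiset \<Rightarrow> bool" where
  "hash_family N M \<H> \<longleftrightarrow> \<H> \<noteq> {#} \<and> set_mset \<H> \<subseteq> {1..N} \<rightarrow>\<^sub>E {1..M}"

text \<open>
  A hash family is a multiset, and its repeated members are kept apart: the member \<open>(h, j)\<close>
  is the \<open>j\<close>-th copy of the function \<open>h\<close>.  Thus there are \<open>size \<H>\<close> members, and a uniformly
  random member \<open>H\<close> has \<open>cp H = 1 / size \<H>\<close> also when functions are repeated.
\<close>

definition members :: "(nat \<Rightarrow> nat) multiset \<Rightarrow> ((nat \<Rightarrow> nat) \<times> nat) set" where
  "members \<H> = (SIGMA h : set_mset \<H>. {..<count \<H> h})"

text \<open>The distribution of \<open>(H, H(X\<^sub>1), \<dots>, H(X\<^sub>T))\<close> for \<open>H\<close> independent of \<open>X\<close>.\<close>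

definition hashed ::
    "(nat \<Rightarrow> nat) multiset \<Rightarrow> nat list pmf \<Rightarrow> (((nat \<Rightarrow> nat) \<times> nat) \<times> nat list) pmf" where
  "hashed \<H> X =
     map_pmf (\<lambda>(m, xs). (m, map (fst m) xs)) (pair_pmf (pmf_of_set (members \<H>)) X)"

text \<open>
  Two degenerate cases have to be kept out of the lower bound on block sources.  For
  \<open>M = 1\<close> the tuple of hash values is constant, so \<open>(H, Y)\<close> itself has collision probability
  \<open>1 / size \<H>\<close> and the claim fails; hence \<open>M \<ge> 2\<close>.  As \<open>\<alpha> / \<delta>\<close> tends to \<open>1\<close>, the quantity
  \<open>\<delta>\<^sup>2 M T / ln (\<alpha> / \<delta>)\<close> exceeds every multiple of \<open>N = M T\<close>, while a block \<open>K\<close>-source over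
  \<open>[N]\<close> needs \<open>K \<le> N\<close>; hence the logarithm is read as \<open>max 1 (ln (\<alpha> / \<delta>))\<close>, which
  agrees with \<open>ln (\<alpha> / \<delta>)\<close> as soon as \<open>\<alpha> / \<delta> \<ge> exp 1\<close>.
\<close>

end

theory Submission
  imports Defs
begin

text \<open>
  The blocks of \<open>X\<close> are independent.  Block \<open>i\<close> lives on \<open>R = {1..3 * K}\<close> and gives the point
  \<open>x\<close> a weight proportional to \<open>2 \<plusminus> 1\<close>, the sign being read off a set \<open>A\<^sub>i \<subseteq> R\<close>: it is
  positive iff \<open>x \<in> A\<^sub>i\<close>.  For a fixed \<open>h : [N] \<rightarrow> [M]\<close> and a value \<open>y\<close>, either the number of
  \<open>x \<in> R\<close> with \<open>h x = y\<close> is far below \<open>|R| / M\<close>, or Khintchine's inequality applies to the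
  signs; in both cases the probability of \<open>y\<close> differs from \<open>1 / M\<close> by order \<open>1 / sqrt (M K)\<close>
  on average over \<open>A\<^sub>i\<close>.  Hence the Bhattacharyya affinity of the hashed block with the uniform
  distribution is on average at most \<open>1 - \<Omega>(M / K)\<close>.  Affinity is multiplicative over the blocks,
  so for a suitable choice of the \<open>A\<^sub>i\<close> the affinity of \<open>(H, Y)\<close> with the uniform distribution is
  at most \<open>exp (- \<Omega>(M T / K)) \<le> \<delta>\<^sup>2 / (4 sqrt \<alpha>)\<close>.  Then the likelihood ratio test separates
  \<open>(H, Y)\<close> from every distribution of small collision probability.  If \<open>K \<le> M / 2\<close>, the hash values
  of a uniform block on \<open>K\<close> points already miss half of \<open>[M]\<close>.
\<close>

subsection \<open>Collision probability and the likelihood ratio test\<close>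

lemma stat_dist_ge:
  "measure_pmf.prob p S - measure_pmf.prob q S \<le> stat_dist p q"
proof -
  have "bdd_above (range (\<lambda>S. \<bar>measure_pmf.prob p S - measure_pmf.prob q S\<bar>))"
    by (intro bdd_aboveI[of _ 1]) (auto simp: abs_le_iff intro: order_trans[OF _ measure_pmf.prob_le_1]
        order_trans[OF diff_left_mono[OF measure_nonneg]] simp: algebra_simps add_increasing add_increasing2)
  then have "\<bar>measure_pmf.prob p S - measure_pmf.prob q S\<bar> \<le> stat_dist p q"
    unfolding stat_dist_def by (rule cSUP_upper[rotated]) simp
  then show ?thesis by linarith
qed

lemma cp_finite_support:
  assumes "finite D" "set_pmf p \<subseteq> D"
  shows "cp p = (\<Sum>x\<in>D. (pmf p x)\<^sup>2)"
proof -
  have "cp p = (\<Sum>\<^sub>\<infinity>x\<in>D. (pmf p x)\<^sup>2)"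
    unfolding cp_def using assms by (intro infsum_cong_neutral) (auto simp: set_pmf_iff)
  then show ?thesis using assms by simp
qed

text \<open>The test set \<open>A\<close> consists of the points where \<open>P\<close> is at least
  \<open>\<theta>\<close> times the uniform density on \<open>D\<close>. It holds at most a fraction
  \<open>1 / \<theta>\<close> of \<open>D\<close>, so Cauchy-Schwarz and the collision bound make
  \<open>Q\<close> small on it. Outside \<open>A\<close>, \<open>pmf P d\<close> is at most
  \<open>sqrt \<theta>\<close> times the affinity term, so \<open>P\<close> is small there.\<close>

lemma far_of_affinity:
  fixes P Q :: "'a pmf"
  assumes D: "finite D" "set_pmf P \<subseteq> D" "set_pmf Q \<subseteq> D"
    and \<delta>: "0 < \<delta>" and \<alpha>: "0 < \<alpha>"
    and cpQ: "cp Q \<le> \<alpha> / card D"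
    and aff: "(\<Sum>d\<in>D. sqrt (pmf P d / card D)) \<le> \<delta>\<^sup>2 / (4 * sqrt \<alpha>)"
  shows "far (1 - \<delta>) P Q"
proof -
  define n where "n = real (card D)"
  have "D \<noteq> {}" using D(2) set_pmf_not_empty[of P] by auto
  then have n: "n > 0" using D(1) by (simp add: n_def card_gt_0_iff)
  \<comment> \<open>This threshold balances the two errors:
    \<open>sqrt (\<alpha> / \<theta>)\<close> for \<open>Q\<close> on \<open>A\<close>, and
    \<open>sqrt \<theta>\<close> times the affinity bound for \<open>P\<close> outside
    \<open>A\<close>, both equal \<open>\<delta> / 2\<close>.\<close>
  define \<theta> where "\<theta> = 4 * \<alpha> / \<delta>\<^sup>2"
  have \<theta>: "\<theta> > 0" using \<delta> \<alpha> by (simp add: \<theta>_def)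
  define A where "A = {d\<in>D. pmf P d \<ge> \<theta> / n}"
  have A: "A \<subseteq> D" "finite A" using D(1) by (auto simp: A_def)
  have "\<theta> * (card A / n) \<le> (\<Sum>d\<in>A. pmf P d)"
    using sum_bounded_below[of A "\<theta> / n" "pmf P"] by (auto simp: A_def mult.commute)
  also have "\<dots> \<le> 1"
    using A(2) by (simp add: measure_measure_pmf_finite[symmetric])
  finally have "card A / n \<le> 1 / \<theta>"
    using \<theta> by (subst pos_le_divide_eq) (simp_all add: mult.commute)
  then have cardA: "card A / n \<le> \<delta>\<^sup>2 / (4 * \<alpha>)"
    by (simp add: \<theta>_def)
  have "(measure_pmf.prob Q A)\<^sup>2 = (\<Sum>d\<in>A. 1 * pmf Q d)\<^sup>2"
    using A by (simp add: measure_measure_pmf_finite)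
  also have "\<dots> \<le> (\<Sum>d\<in>A. 1\<^sup>2) * (\<Sum>d\<in>A. (pmf Q d)\<^sup>2)"
    by (rule Cauchy_Schwarz_ineq_sum)
  also have "\<dots> \<le> (\<Sum>d\<in>A. 1\<^sup>2) * (\<alpha> / n)"
  proof (rule mult_left_mono)
    have "(\<Sum>d\<in>A. (pmf Q d)\<^sup>2) \<le> cp Q"
      unfolding cp_finite_support[OF D(1,3)] using A D(1) by (intro sum_mono2) auto
    then show "(\<Sum>d\<in>A. (pmf Q d)\<^sup>2) \<le> \<alpha> / n" using cpQ by (simp add: n_def)
  qed simp
  also have "\<dots> = \<alpha> * (card A / n)" by simp
  also have "\<dots> \<le> \<alpha> * (\<delta>\<^sup>2 / (4 * \<alpha>))" using cardA \<alpha> by (intro mult_left_mono) auto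
  also have "\<dots> = (\<delta> / 2)\<^sup>2" using \<alpha> by (simp add: power2_eq_square)
  finally have QA: "measure_pmf.prob Q A \<le> \<delta> / 2"
    using \<delta> by (auto intro: power2_le_imp_le)
  have "measure_pmf.prob P (D - A) = (\<Sum>d\<in>D - A. pmf P d)"
    using D by (simp add: measure_measure_pmf_finite)
  also have "\<dots> \<le> (\<Sum>d\<in>D - A. sqrt \<theta> * sqrt (pmf P d / n))"
  proof (rule sum_mono)
    fix d assume "d \<in> D - A"
    then have "pmf P d \<le> \<theta> / n" by (auto simp: A_def)
    then have "(pmf P d)\<^sup>2 \<le> \<theta> / n * pmf P d"
      unfolding power2_eq_square by (intro mult_right_mono) auto
    then have "pmf P d \<le> sqrt (\<theta> * (pmf P d / n))"
      by (intro real_le_rsqrt) (simp add: mult.commute)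
    then show "pmf P d \<le> sqrt \<theta> * sqrt (pmf P d / n)"
      by (simp only: real_sqrt_mult)
  qed
  also have "\<dots> \<le> (\<Sum>d\<in>D. sqrt \<theta> * sqrt (pmf P d / n))"
    using D \<theta> n by (intro sum_mono2) auto
  also have "\<dots> \<le> sqrt \<theta> * (\<delta>\<^sup>2 / (4 * sqrt \<alpha>))"
    unfolding sum_distrib_left[symmetric] using aff \<theta> by (intro mult_left_mono) (auto simp: n_def)
  also have "sqrt \<theta> = 2 * sqrt \<alpha> / \<delta>"
    using \<delta> by (simp add: \<theta>_def real_sqrt_divide real_sqrt_mult)
  also have "2 * sqrt \<alpha> / \<delta> * (\<delta>\<^sup>2 / (4 * sqrt \<alpha>)) = \<delta> / 2"
    using \<delta> \<alpha> by (simp add: field_simps power2_eq_square)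
  finally have PA: "measure_pmf.prob P (D - A) \<le> \<delta> / 2" .
  have "measure_pmf.prob P D = 1"
    using D(2) by (simp add: measure_pmf.prob_eq_1 AE_measure_pmf_iff subset_iff)
  then have "measure_pmf.prob P A = 1 - measure_pmf.prob P (D - A)"
    using A(1) by (simp add: measure_pmf.finite_measure_Diff)
  then show ?thesis
    using stat_dist_ge[of P A Q] QA PA unfolding far_def by linarith
qed

subsection \<open>Sources with independent blocks\<close>

text \<open>The product distribution with the given marginals, built on lists because a block source
  is a \<open>pmf\<close> of lists.\<close>

primrec list_pmf :: "'a pmf list \<Rightarrow> 'a list pmf" where
  "list_pmf [] = return_pmf []"
| "list_pmf (p # ps) = map_pmf (\<lambda>(x, xs). x # xs) (pair_pmf p (list_pmf ps))"

lemma inj_Cons_pair: "inj (\<lambda>(x, xs). x # xs)"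
  by (auto simp: inj_def)

lemma pmf_list_pmf:
  "length ps = length xs \<Longrightarrow> pmf (list_pmf ps) xs = prod_list (map2 pmf ps xs)"
proof (induction ps xs rule: list_induct2)
  case (Cons p ps x xs)
  have "pmf (list_pmf (p # ps)) (x # xs) = pmf (pair_pmf p (list_pmf ps)) (x, xs)"
    using pmf_map_inj'[OF inj_Cons_pair, of _ "(x, xs)"] by simp
  then show ?case using Cons by (simp add: pmf_pair)
qed simp

lemma set_list_pmf:
  "xs \<in> set_pmf (list_pmf ps) \<Longrightarrow> list_all2 (\<lambda>x p. x \<in> set_pmf p) xs ps"
  by (induction ps arbitrary: xs) auto

lemma map_list_pmf: "map_pmf (map f) (list_pmf ps) = list_pmf (map (map_pmf f) ps)"
proof (induction ps)
  case (Cons p ps)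
  have "map_pmf (map f) (list_pmf (p # ps)) =
      map_pmf (\<lambda>(x, xs). x # xs) (map_pmf (map_prod f (map f)) (pair_pmf p (list_pmf ps)))"
    by (simp add: pmf.map_comp o_def case_prod_beta)
  also have "map_pmf (map_prod f (map f)) (pair_pmf p (list_pmf ps)) =
      pair_pmf (map_pmf f p) (map_pmf (map f) (list_pmf ps))"
    by (simp add: pair_map_pmf1 pair_map_pmf2 pmf.map_comp o_def map_prod_def split_beta')
  finally show ?case by (simp add: Cons)
qed simp

text \<open>Independence of an entry from the prefix before it, stated as a joint law so that the
  conditioning in \<open>block_source\<close> reduces to a quotient of probabilities.\<close>

lemma list_pmf_take_nth:
  "i < length ps \<Longrightarrow>
     map_pmf (\<lambda>xs. (take i xs, xs ! i)) (list_pmf ps) =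
     pair_pmf (map_pmf (take i) (list_pmf ps)) (ps ! i)"
proof (induction ps arbitrary: i)
  case (Cons p ps)
  show ?case
  proof (cases i)
    case 0
    have "map_pmf (\<lambda>xs. (take i xs, xs ! i)) (list_pmf (p # ps)) =
        map_pmf (Pair []) (map_pmf fst (pair_pmf p (list_pmf ps)))"
      by (simp add: pmf.map_comp o_def case_prod_beta 0)
    also have "\<dots> = pair_pmf (return_pmf []) p"
      by (simp add: map_fst_pair_pmf pair_return_pmf1)
    finally show ?thesis by (simp add: 0 map_pmf_const)
  next
    case (Suc j)
    then have j: "j < length ps" using Cons.prems by simp
    have "map_pmf (\<lambda>xs. (take i xs, xs ! i)) (list_pmf (p # ps)) =
        map_pmf (\<lambda>(x, (t, y)). (x # t, y))
          (pair_pmf p (map_pmf (\<lambda>xs. (take j xs, xs ! j)) (list_pmf ps)))"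
      by (simp add: Suc pair_map_pmf2 pmf.map_comp o_def case_prod_beta)
    also have "\<dots> = map_pmf (\<lambda>(x, (t, y)). (x # t, y))
        (pair_pmf p (pair_pmf (map_pmf (take j) (list_pmf ps)) (ps ! j)))"
      by (simp only: Cons.IH[OF j])
    also have "\<dots> = pair_pmf (map_pmf (\<lambda>(x, t). x # t)
        (pair_pmf p (map_pmf (take j) (list_pmf ps)))) (ps ! j)"
      by (simp add: pair_pmf_def map_pmf_def bind_assoc_pmf bind_return_pmf case_prod_beta)
    also have "map_pmf (\<lambda>(x, t). x # t) (pair_pmf p (map_pmf (take j) (list_pmf ps))) =
        map_pmf (take i) (list_pmf (p # ps))"
      by (simp add: Suc pair_map_pmf2 pmf.map_comp o_def case_prod_beta)
    finally show ?thesis using Suc by simp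
  qed
qed simp

text \<open>By independence, conditioning on a prefix leaves the law of block \<open>i\<close> equal
  to \<open>ps ! i\<close>, so the collision bound is needed only for the marginals.\<close>

lemma block_source_list_pmf:
  assumes len: "length ps = T"
    and supp: "\<And>p. p \<in> set ps \<Longrightarrow> set_pmf p \<subseteq> {1..N}"
    and cp: "\<And>p. p \<in> set ps \<Longrightarrow> cp p \<le> 1 / real K"
  shows "block_source K N T (list_pmf ps)"
  unfolding block_source_def
proof (intro conjI allI impI ballI)
  show "set_pmf (list_pmf ps) \<subseteq> tuples N T"
  proof
    fix xs assume "xs \<in> set_pmf (list_pmf ps)"
    then have *: "list_all2 (\<lambda>x p. x \<in> set_pmf p) xs ps" by (rule set_list_pmf)
    then have "x \<in> {1..N}" if "x \<in> set xs" for x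
      using that supp by (fastforce simp: list_all2_conv_all_nth in_set_conv_nth)
    then show "xs \<in> tuples N T"
      using * len by (auto simp: tuples_def dest: list_all2_lengthD)
  qed
next
  fix i t assume i: "i < T" and t: "t \<in> set_pmf (map_pmf (take i) (list_pmf ps))"
  let ?X = "list_pmf ps" and ?E = "{xs. take i xs = t}"
  have ne: "set_pmf ?X \<inter> ?E \<noteq> {}" using t by auto
  have pos: "measure_pmf.prob ?X ?E > 0"
    using ne by (simp add: measure_measure_pmf_not_zero zero_less_measure_iff)
  have "map_pmf (\<lambda>xs. xs ! i) (cond_pmf ?X ?E) = ps ! i"
  proof (rule pmf_eqI)
    fix x
    have "pmf (map_pmf (\<lambda>xs. xs ! i) (cond_pmf ?X ?E)) x =
        measure_pmf.prob ?X (?E \<inter> {xs. xs ! i = x}) / measure_pmf.prob ?X ?E"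
      by (simp add: pmf_map vimage_def cond_pmf.rep_eq[OF ne] measure_uniform_measure
          emeasure_measure_pmf_not_zero[OF ne])
    also have "measure_pmf.prob ?X (?E \<inter> {xs. xs ! i = x}) =
        pmf (map_pmf (\<lambda>xs. (take i xs, xs ! i)) ?X) (t, x)"
      by (simp add: pmf_map vimage_def Int_def)
    also have "\<dots> = measure_pmf.prob ?X ?E * pmf (ps ! i) x"
      using i len by (simp add: list_pmf_take_nth pmf_pair pmf_map vimage_def)
    finally show "pmf (map_pmf (\<lambda>xs. xs ! i) (cond_pmf ?X ?E)) x = pmf (ps ! i) x"
      using pos by simp
  qed
  then show "cp (map_pmf (\<lambda>xs. xs ! i) (cond_pmf ?X ?E)) \<le> 1 / real K"
    using cp i len by simp
qed

section \<open>Sums over tuples as powers\<close>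

lemma sum_lists_Suc:
  fixes F :: "'a list \<Rightarrow> real"
  shows "(\<Sum>xs | set xs \<subseteq> A \<and> length xs = Suc n. F xs) =
    (\<Sum>x\<in>A. \<Sum>xs | set xs \<subseteq> A \<and> length xs = n. F (x # xs))"
proof -
  have "(\<Sum>xs | set xs \<subseteq> A \<and> length xs = Suc n. F xs) =
      (\<Sum>(x, xs)\<in>A \<times> {xs. set xs \<subseteq> A \<and> length xs = n}. F (x # xs))"
    by (rule sum.reindex_bij_witness[of _ "\<lambda>(x, xs). x # xs" "\<lambda>xs. (hd xs, tl xs)"])
      (auto simp: length_Suc_conv)
  then show ?thesis by (simp add: sum.cartesian_product)
qed

text \<open>Distributivity, one coordinate at a time. With \<open>f\<close> the affinity term of a
  block law and a hash value, it evaluates the affinity summed over all choices of block laws as a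
  power of the sum for one block.\<close>

lemma sum_lists_prod_list:
  fixes f :: "'a \<Rightarrow> 'b \<Rightarrow> real"
  shows "(\<Sum>xs | set xs \<subseteq> A \<and> length xs = n. \<Sum>ys | set ys \<subseteq> B \<and> length ys = n.
      prod_list (map2 f xs ys)) = (\<Sum>x\<in>A. \<Sum>y\<in>B. f x y) ^ n"
proof (induction n)
  case (Suc n)
  let ?L = "\<lambda>C. {xs. set xs \<subseteq> C \<and> length xs = n}"
  have "(\<Sum>xs | set xs \<subseteq> A \<and> length xs = Suc n. \<Sum>ys | set ys \<subseteq> B \<and> length ys = Suc n.
      prod_list (map2 f xs ys)) =
      (\<Sum>x\<in>A. \<Sum>xs\<in>?L A. \<Sum>y\<in>B. f x y * (\<Sum>ys\<in>?L B. prod_list (map2 f xs ys)))"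
    by (simp add: sum_lists_Suc sum_distrib_left)
  also have "\<dots> = (\<Sum>x\<in>A. \<Sum>y\<in>B. \<Sum>xs\<in>?L A. f x y * (\<Sum>ys\<in>?L B. prod_list (map2 f xs ys)))"
    by (intro sum.cong refl sum.swap)
  also have "\<dots> = (\<Sum>x\<in>A. \<Sum>y\<in>B. f x y) * (\<Sum>x\<in>A. \<Sum>y\<in>B. f x y) ^ n"
    by (simp add: Suc sum_distrib_left[symmetric] sum_distrib_right)
  finally show ?case by simp
qed (simp add: Collect_conv_if)

section \<open>The joint law of the hash function and its values\<close>

lemma members_props:
  assumes "hash_family N M \<H>"
  shows "finite (members \<H>)" "members \<H> \<noteq> {}" "card (members \<H>) = size \<H>"
    "size \<H> > 0" "m \<in> members \<H> \<Longrightarrow> fst m \<in> {1..N} \<rightarrow>\<^sub>E {1..M}"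
proof -
  show fin: "finite (members \<H>)" by (simp add: members_def)
  show card: "card (members \<H>) = size \<H>"
    by (simp add: members_def size_multiset_overloaded_eq)
  show pos: "size \<H> > 0" using assms by (simp add: hash_family_def nonempty_has_size)
  show "members \<H> \<noteq> {}" using card pos by auto
  assume "m \<in> members \<H>"
  then have "fst m \<in># \<H>" by (auto simp: members_def)
  then show "fst m \<in> {1..N} \<rightarrow>\<^sub>E {1..M}"
    using assms unfolding hash_family_def by blast
qed

lemma tuples_eq: "tuples M T = {xs. set xs \<subseteq> {1..M} \<and> length xs = T}"
  by (auto simp: tuples_def)

lemma finite_tuples: "finite (tuples M T)"
  by (simp add: tuples_eq finite_lists_length_eq)

lemma card_tuples: "card (tuples M T) = M ^ T"
  by (simp add: tuples_eq card_lists_length_eq)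

text \<open>The outcome records the member, copy index included, so only the summand
  \<open>m' = m\<close> of the mixture over members contributes.\<close>

lemma pmf_hashed:
  assumes "hash_family N M \<H>" "m \<in> members \<H>"
  shows "pmf (hashed \<H> X) (m, ys) = pmf (map_pmf (map (fst m)) X) ys / size \<H>"
proof -
  have "hashed \<H> X = bind_pmf (pmf_of_set (members \<H>))
      (\<lambda>m. map_pmf (Pair m) (map_pmf (map (fst m)) X))"
    by (simp add: hashed_def pair_pmf_def map_pmf_def bind_assoc_pmf bind_return_pmf)
  then have "pmf (hashed \<H> X) (m, ys) = (\<Sum>m'\<in>members \<H>.
      pmf (map_pmf (Pair m') (map_pmf (map (fst m')) X)) (m, ys)) / size \<H>"
    using members_props[OF assms(1)] by (simp add: pmf_bind integral_pmf_of_set)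
  also have "(\<Sum>m'\<in>members \<H>. pmf (map_pmf (Pair m') (map_pmf (map (fst m')) X)) (m, ys)) =
      (\<Sum>m'\<in>members \<H>. if m' = m then pmf (map_pmf (map (fst m)) X) ys else 0)"
  proof (intro sum.cong refl)
    fix m'
    show "pmf (map_pmf (Pair m') (map_pmf (map (fst m')) X)) (m, ys) =
        (if m' = m then pmf (map_pmf (map (fst m)) X) ys else 0)"
      by (cases "m' = m") (auto simp: pmf_map_inj' inj_def pmf_eq_0_set_pmf)
  qed
  also have "\<dots> = pmf (map_pmf (map (fst m)) X) ys"
    using assms(2) members_props(1)[OF assms(1)] by simp
  finally show ?thesis .
qed

lemma sqrt_prod_list_div_power:
  "length xs = length ys \<Longrightarrow>
    sqrt (prod_list (map2 f xs ys) / c ^ length xs) = prod_list (map2 (\<lambda>x y. sqrt (f x y / c)) xs ys)"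
proof (induction xs ys rule: list_induct2)
  case (Cons x xs y ys)
  have "sqrt (prod_list (map2 f (x # xs) (y # ys)) / c ^ length (x # xs)) =
      sqrt (f x y / c * (prod_list (map2 f xs ys) / c ^ length xs))"
    by simp
  then show ?case unfolding real_sqrt_mult Cons.IH by simp
qed simp

text \<open>Probabilistic method: \<open>w s\<close> ranges over candidate block laws, and for each
  fixed hash function the affinity with the uniform distribution is at most \<rho> on average over
  \<open>s\<close>. Averaging over all tuples \<open>ss\<close> raises this to the power
  \<open>T\<close>. Interchanging this average with the one over the members yields a single
  \<open>ss\<close>, chosen without knowledge of the hash function, whose overall affinity is at
  most \<open>\<rho> ^ T\<close>.\<close>

lemma exists_block_source:
  fixes w :: "'s \<Rightarrow> nat pmf" and \<delta> \<alpha> \<rho> :: real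
  assumes \<H>: "hash_family N M \<H>" and M: "M > 0" and \<delta>: "0 < \<delta>" and \<alpha>: "0 < \<alpha>"
    and S: "finite S" "S \<noteq> {}"
    and w: "\<And>s. s \<in> S \<Longrightarrow> set_pmf (w s) \<subseteq> {1..N}" "\<And>s. s \<in> S \<Longrightarrow> cp (w s) \<le> 1 / real K"
    and aff: "\<And>h. h \<in> {1..N} \<rightarrow> {1..M} \<Longrightarrow>
      (\<Sum>s\<in>S. \<Sum>y\<in>{1..M}. sqrt (pmf (map_pmf h (w s)) y / M)) \<le> card S * \<rho>"
    and \<rho>: "\<rho> ^ T \<le> \<delta>\<^sup>2 / (4 * sqrt \<alpha>)"
  shows "\<exists>X. block_source K N T X \<and>
    (\<forall>Q. set_pmf Q \<subseteq> members \<H> \<times> tuples M T \<longrightarrow>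
      cp Q \<le> \<alpha> / (real (size \<H>) * real M ^ T) \<longrightarrow> far (1 - \<delta>) (hashed \<H> X) Q)"
proof -
  define L where "L = {ss. set ss \<subseteq> S \<and> length ss = T}"
  define aff_h where "aff_h h ss = (\<Sum>ys\<in>tuples M T.
    prod_list (map2 (\<lambda>s y. sqrt (pmf (map_pmf h (w s)) y / M)) ss ys))" for h ss
  have L: "finite L" "card L = card S ^ T"
    using S by (simp_all add: L_def finite_lists_length_eq card_lists_length_eq)
  then have cardL: "card L > 0" using S by (simp add: card_gt_0_iff)
  note mem = members_props[OF \<H>]
  have "(\<Sum>ss\<in>L. \<Sum>m\<in>members \<H>. aff_h (fst m) ss) = (\<Sum>m\<in>members \<H>. \<Sum>ss\<in>L. aff_h (fst m) ss)"
    by (rule sum.swap)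
  also have "\<dots> \<le> (\<Sum>m\<in>members \<H>. card L * \<rho> ^ T)"
  proof (rule sum_mono)
    fix m assume "m \<in> members \<H>"
    then have h: "fst m \<in> {1..N} \<rightarrow> {1..M}" using mem(5) by (auto simp: PiE_def)
    have "(\<Sum>ss\<in>L. aff_h (fst m) ss) =
        (\<Sum>s\<in>S. \<Sum>y\<in>{1..M}. sqrt (pmf (map_pmf (fst m) (w s)) y / M)) ^ T"
      unfolding L_def aff_h_def tuples_eq by (rule sum_lists_prod_list)
    also have "\<dots> \<le> (card S * \<rho>) ^ T"
      using aff[OF h] by (intro power_mono) (auto intro!: sum_nonneg)
    finally show "(\<Sum>ss\<in>L. aff_h (fst m) ss) \<le> card L * \<rho> ^ T"
      by (simp add: L power_mult_distrib)
  qed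
  also have "\<dots> = (\<Sum>ss\<in>L. size \<H> * \<rho> ^ T)" by (simp add: mem)
  finally obtain ss where ss: "ss \<in> L" "(\<Sum>m\<in>members \<H>. aff_h (fst m) ss) \<le> size \<H> * \<rho> ^ T"
    using sum_strict_mono[of L "\<lambda>_. size \<H> * \<rho> ^ T" "\<lambda>ss. \<Sum>m\<in>members \<H>. aff_h (fst m) ss"]
      L cardL by (force simp: not_le card_gt_0_iff)
  then have len: "length ss = T" and sS: "set ss \<subseteq> S" by (auto simp: L_def)
  define X where "X = list_pmf (map w ss)"
  have blk: "block_source K N T X"
    unfolding X_def using len sS w by (intro block_source_list_pmf) auto
  let ?D = "members \<H> \<times> tuples M T"
  have cardD: "real (card ?D) = real (size \<H>) * real M ^ T"
    by (simp add: card_cartesian_product mem card_tuples)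
  have supp: "set_pmf (hashed \<H> X) \<subseteq> ?D"
  proof -
    have "map (fst m) xs \<in> tuples M T" if "m \<in> members \<H>" "xs \<in> set_pmf X" for m xs
    proof -
      have "xs \<in> tuples N T" using blk that(2) by (auto simp: block_source_def)
      moreover have "fst m ` {1..N} \<subseteq> {1..M}"
        using mem(5)[OF that(1)] unfolding PiE_iff by blast
      ultimately show ?thesis by (auto simp: tuples_def)
    qed
    then show ?thesis
      using mem(1,2) by (auto simp: hashed_def set_pmf_of_set)
  qed
  have "(\<Sum>d\<in>?D. sqrt (pmf (hashed \<H> X) d / card ?D)) =
      (\<Sum>m\<in>members \<H>. \<Sum>ys\<in>tuples M T. sqrt (pmf (hashed \<H> X) (m, ys) / (real (size \<H>) * real M ^ T)))"
    unfolding cardD by (simp add: sum.cartesian_product)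
  also have "\<dots> = (\<Sum>m\<in>members \<H>. aff_h (fst m) ss / size \<H>)"
  proof (intro sum.cong refl)
    fix m assume m: "m \<in> members \<H>"
    have "sqrt (pmf (hashed \<H> X) (m, ys) / (real (size \<H>) * real M ^ T)) =
        prod_list (map2 (\<lambda>s y. sqrt (pmf (map_pmf (fst m) (w s)) y / M)) ss ys) / size \<H>"
      if "ys \<in> tuples M T" for ys
    proof -
      have l: "length ss = length ys" using that len by (simp add: tuples_def)
      \<comment> \<open>One factor \<open>size \<H>\<close> comes from the uniform choice of the
        member, the other from the uniform density on \<open>?D\<close>; the square root leaves one
        of them.\<close>
      have "pmf (hashed \<H> X) (m, ys) / (real (size \<H>) * real M ^ T) =
          prod_list (map2 (\<lambda>s. pmf (map_pmf (fst m) (w s))) ss ys) / real M ^ length ss / (real (size \<H>))\<^sup>2"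
        using l len
        by (simp add: pmf_hashed[OF \<H> m] X_def map_list_pmf pmf_list_pmf zip_map1 o_def
            split_beta' power2_eq_square ac_simps)
      then show ?thesis
        by (simp only: real_sqrt_divide[of _ "(real (size \<H>))\<^sup>2"]
            sqrt_prod_list_div_power[OF l] real_sqrt_abs abs_of_nat)
    qed
    then show "(\<Sum>ys\<in>tuples M T. sqrt (pmf (hashed \<H> X) (m, ys) / (real (size \<H>) * real M ^ T))) =
        aff_h (fst m) ss / size \<H>"
      by (simp add: aff_h_def sum_divide_distrib)
  qed
  also have "\<dots> \<le> \<rho> ^ T"
    using ss(2) mem(4) by (simp add: sum_divide_distrib[symmetric] divide_le_eq mult.commute)
  finally have "(\<Sum>d\<in>?D. sqrt (pmf (hashed \<H> X) d / card ?D)) \<le> \<delta>\<^sup>2 / (4 * sqrt \<alpha>)"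
    using \<rho> by linarith
  then have "far (1 - \<delta>) (hashed \<H> X) Q"
    if "set_pmf Q \<subseteq> ?D" "cp Q \<le> \<alpha> / (real (size \<H>) * real M ^ T)" for Q
    using that mem(1) finite_tuples supp \<delta> \<alpha> unfolding cardD[symmetric]
    by (intro far_of_affinity[where D = ?D and \<alpha> = \<alpha>]) auto
  then show ?thesis using blk by blast
qed

subsection \<open>First absolute moment of signed sums\<close>

text \<open>A Rademacher sum: for \<open>A\<close> uniform in \<open>Pow F\<close> the signs are
  fair and independent, and sums over \<open>Pow F\<close> are \<open>2 ^ card F\<close> times
  expectations.\<close>

definition signed_sum :: "('a \<Rightarrow> real) \<Rightarrow> 'a set \<Rightarrow> 'a set \<Rightarrow> real" where
  "signed_sum a F A = (\<Sum>x\<in>F. if x \<in> A then a x else - a x)"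

lemma sum_Pow_insert:
  fixes f :: "'a set \<Rightarrow> real"
  assumes "finite F" "x \<notin> F"
  shows "(\<Sum>A\<in>Pow (insert x F). f A) = (\<Sum>A\<in>Pow F. f A + f (insert x A))"
proof -
  have "inj_on (insert x) (Pow F)" using assms(2) by (auto simp: inj_on_def)
  then show ?thesis using assms
    by (subst Pow_insert, subst sum.union_disjoint) (auto simp: sum.reindex sum.distrib)
qed

lemma signed_sum_insert:
  assumes "finite F" "x \<notin> F" "A \<subseteq> F"
  shows "signed_sum a (insert x F) A = signed_sum a F A - a x"
    and "signed_sum a (insert x F) (insert x A) = signed_sum a F A + a x"
proof -
  have "x \<notin> A" using assms by auto
  then show "signed_sum a (insert x F) A = signed_sum a F A - a x"
    using assms by (simp add: signed_sum_def)
  have "(\<Sum>y\<in>F. if y \<in> insert x A then a y else - a y) = signed_sum a F A"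
    unfolding signed_sum_def using assms by (intro sum.cong) auto
  then show "signed_sum a (insert x F) (insert x A) = signed_sum a F A + a x"
    unfolding signed_sum_def using assms by simp
qed

text \<open>Induction on \<open>F\<close>: a new element \<open>x\<close> turns each value
  \<open>Z\<close> into the pair \<open>Z - a x\<close>, \<open>Z + a x\<close>, and the odd powers
  of \<open>a x\<close> cancel.\<close>

lemma sum_signed_sum_moments:
  assumes "finite F"
  shows "(\<Sum>A\<in>Pow F. (signed_sum a F A)\<^sup>2) = 2 ^ card F * (\<Sum>x\<in>F. (a x)\<^sup>2)"
    and "(\<Sum>A\<in>Pow F. (signed_sum a F A) ^ 4) \<le> 2 ^ card F * (3 * (\<Sum>x\<in>F. (a x)\<^sup>2)\<^sup>2)"
proof -
  have "(\<Sum>A\<in>Pow F. (signed_sum a F A)\<^sup>2) = 2 ^ card F * (\<Sum>x\<in>F. (a x)\<^sup>2) \<and>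
      (\<Sum>A\<in>Pow F. (signed_sum a F A) ^ 4) \<le> 2 ^ card F * (3 * (\<Sum>x\<in>F. (a x)\<^sup>2)\<^sup>2)"
    using assms
  proof (induction F)
    case empty
    then show ?case by (simp add: signed_sum_def)
  next
    case (insert x F)
    let ?Z = "signed_sum a F" and ?s = "\<Sum>x\<in>F. (a x)\<^sup>2"
    have "(\<Sum>A\<in>Pow (insert x F). (signed_sum a (insert x F) A)\<^sup>2) =
        (\<Sum>A\<in>Pow F. 2 * (?Z A)\<^sup>2 + 2 * (a x)\<^sup>2)"
      using insert(1,2) by (simp add: sum_Pow_insert)
        (intro sum.cong, auto simp: signed_sum_insert power2_eq_square algebra_simps)
    also have "\<dots> = 2 ^ card (insert x F) * (\<Sum>x\<in>insert x F. (a x)\<^sup>2)"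
      using insert by (simp add: sum.distrib sum_distrib_left[symmetric] card_Pow algebra_simps)
    finally have 1: "(\<Sum>A\<in>Pow (insert x F). (signed_sum a (insert x F) A)\<^sup>2) =
        2 ^ card (insert x F) * (\<Sum>x\<in>insert x F. (a x)\<^sup>2)" .
    have "(\<Sum>A\<in>Pow (insert x F). (signed_sum a (insert x F) A) ^ 4) =
        (\<Sum>A\<in>Pow F. 2 * (?Z A) ^ 4 + 12 * (a x)\<^sup>2 * (?Z A)\<^sup>2 + 2 * (a x) ^ 4)"
      using insert(1,2) by (simp add: sum_Pow_insert)
        (intro sum.cong, auto simp: signed_sum_insert power2_eq_square power4_eq_xxxx algebra_simps)
    also have "\<dots> = 2 * (\<Sum>A\<in>Pow F. (?Z A) ^ 4) + 12 * (a x)\<^sup>2 * (2 ^ card F * ?s) + 2 ^ card F * (2 * (a x) ^ 4)"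
      using insert by (simp add: sum.distrib sum_distrib_left[symmetric] card_Pow)
    \<comment> \<open>Raising the coefficient 2 of \<open>(a x) ^ 4\<close> to 6 completes the
      square \<open>6 * (?s + (a x)\<^sup>2)\<^sup>2\<close>.\<close>
    also have "\<dots> \<le> 2 * (2 ^ card F * (3 * ?s\<^sup>2)) + 12 * (a x)\<^sup>2 * (2 ^ card F * ?s) + 2 ^ card F * (6 * (a x) ^ 4)"
      using insert by (intro add_mono mult_left_mono) auto
    also have "\<dots> = 2 ^ card (insert x F) * (3 * (\<Sum>x\<in>insert x F. (a x)\<^sup>2)\<^sup>2)"
      using insert(1,2) by (simp add: power2_eq_square power4_eq_xxxx algebra_simps)
    finally show ?case using 1 by simp
  qed
  then show "(\<Sum>A\<in>Pow F. (signed_sum a F A)\<^sup>2) = 2 ^ card F * (\<Sum>x\<in>F. (a x)\<^sup>2)"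
    and "(\<Sum>A\<in>Pow F. (signed_sum a F A) ^ 4) \<le> 2 ^ card F * (3 * (\<Sum>x\<in>F. (a x)\<^sup>2)\<^sup>2)"
    by auto
qed

text \<open>The coefficient \<open>4 / 27\<close> makes the difference of the two sides have a
  double zero at \<open>\<bar>t\<bar> = 3 / 2\<close>. The polynomial minorant reduces a first
  absolute moment to second and fourth moments.\<close>

lemma abs_ge_quartic:
  fixes t :: real
  shows "\<bar>t\<bar> \<ge> t\<^sup>2 - 4 / 27 * t ^ 4"
proof -
  define u where "u = \<bar>t\<bar>"
  have u: "u \<ge> 0" by (simp add: u_def)
  have "0 \<le> 4 / 27 * (u * (u - 3 / 2)\<^sup>2 * (u + 3))" using u by simp
  also have "\<dots> = u - u\<^sup>2 + 4 / 27 * u ^ 4"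
    by (simp add: power2_eq_square power4_eq_xxxx algebra_simps)
  finally show ?thesis by (simp add: u_def)
qed

text \<open>Apply the quartic minorant to the sum divided by its standard deviation
  \<open>s\<close>: the second moment becomes 1, the fourth is at most 3, and
  \<open>1 - 4 / 27 * 3 = 5 / 9\<close>.\<close>

lemma khintchine_lower:
  assumes F: "finite F"
  shows "(\<Sum>A\<in>Pow F. \<bar>signed_sum a F A\<bar>) \<ge> 2 ^ card F * (5 / 9 * sqrt (\<Sum>x\<in>F. (a x)\<^sup>2))"
proof (cases "(\<Sum>x\<in>F. (a x)\<^sup>2) = 0")
  case True
  then show ?thesis by (simp add: sum_nonneg)
next
  case False
  define S where "S = (\<Sum>x\<in>F. (a x)\<^sup>2)"
  define s where "s = sqrt S"
  have S: "S > 0" using False by (simp add: S_def less_le sum_nonneg)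
  then have s: "s > 0" "s\<^sup>2 = S" by (simp_all add: s_def)
  let ?Z = "signed_sum a F" and ?n = "(2::real) ^ card F"
  have s4: "s ^ 4 = S\<^sup>2" unfolding s(2)[symmetric] by simp
  have "?n * (5 / 9 * s) = s * (?n * S / S - 4 / 27 * (?n * (3 * S\<^sup>2)) / S\<^sup>2)"
    using S by simp
  also have "\<dots> \<le> s * ((\<Sum>A\<in>Pow F. (?Z A)\<^sup>2) / S - 4 / 27 * (\<Sum>A\<in>Pow F. (?Z A) ^ 4) / S\<^sup>2)"
    using s sum_signed_sum_moments[OF F, of a] S
    by (intro mult_left_mono diff_mono divide_right_mono) (simp_all add: S_def)
  also have "\<dots> = (\<Sum>A\<in>Pow F. s * ((?Z A / s)\<^sup>2 - 4 / 27 * (?Z A / s) ^ 4))"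
    by (simp add: sum_distrib_left sum_subtractf sum_divide_distrib power_divide s s4 right_diff_distrib)
  also have "\<dots> \<le> (\<Sum>A\<in>Pow F. s * \<bar>?Z A / s\<bar>)"
    using s by (intro sum_mono mult_left_mono abs_ge_quartic) auto
  also have "\<dots> = (\<Sum>A\<in>Pow F. \<bar>?Z A\<bar>)" using s by simp
  finally show ?thesis by (simp add: s_def S_def)
qed

lemma signed_sum_Diff:
  "A \<subseteq> F \<Longrightarrow> signed_sum a F (F - A) = - signed_sum a F A"
  unfolding signed_sum_def sum_negf[symmetric] by (intro sum.cong) auto

text \<open>Complementing \<open>A\<close> flips the sign of \<open>Z\<close>, so
  \<open>\<bar>c + Z\<bar>\<close> may be averaged with \<open>\<bar>c - Z\<bar>\<close>, and the
  sum of these two is at least \<open>2 * \<bar>c\<bar>\<close> and at least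
  \<open>2 * \<bar>Z\<bar>\<close>.\<close>

lemma sum_abs_signed_sum_shift:
  assumes F: "finite F"
  shows "(\<Sum>A\<in>Pow F. \<bar>c + signed_sum a F A\<bar>) \<ge> 2 ^ card F * \<bar>c\<bar>"
    and "(\<Sum>A\<in>Pow F. \<bar>c + signed_sum a F A\<bar>) \<ge> (\<Sum>A\<in>Pow F. \<bar>signed_sum a F A\<bar>)"
proof -
  let ?Z = "signed_sum a F"
  have "(\<Sum>A\<in>Pow F. \<bar>c + ?Z A\<bar>) = (\<Sum>A\<in>Pow F. \<bar>c + ?Z (F - A)\<bar>)"
    by (rule sum.reindex_bij_witness[of _ "\<lambda>A. F - A" "\<lambda>A. F - A"]) (auto simp: double_diff)
  also have "\<dots> = (\<Sum>A\<in>Pow F. \<bar>c - ?Z A\<bar>)"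
    by (intro sum.cong) (auto simp: signed_sum_Diff)
  finally have *: "2 * (\<Sum>A\<in>Pow F. \<bar>c + ?Z A\<bar>) = (\<Sum>A\<in>Pow F. \<bar>c + ?Z A\<bar> + \<bar>c - ?Z A\<bar>)"
    by (simp add: sum.distrib)
  have "(\<Sum>A\<in>Pow F. 2 * \<bar>c\<bar>) \<le> (\<Sum>A\<in>Pow F. \<bar>c + ?Z A\<bar> + \<bar>c - ?Z A\<bar>)"
    by (intro sum_mono) linarith
  then show "(\<Sum>A\<in>Pow F. \<bar>c + ?Z A\<bar>) \<ge> 2 ^ card F * \<bar>c\<bar>"
    unfolding *[symmetric] using F by (simp add: card_Pow)
  have "(\<Sum>A\<in>Pow F. 2 * \<bar>?Z A\<bar>) \<le> (\<Sum>A\<in>Pow F. \<bar>c + ?Z A\<bar> + \<bar>c - ?Z A\<bar>)"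
    by (intro sum_mono) linarith
  then show "(\<Sum>A\<in>Pow F. \<bar>c + ?Z A\<bar>) \<ge> (\<Sum>A\<in>Pow F. \<bar>?Z A\<bar>)"
    unfolding *[symmetric] by (simp add: sum_distrib_left[symmetric])
qed

text \<open>Factor \<open>p y - q y\<close> as a difference of squares of roots. Cauchy-Schwarz
  bounds the squared sum by \<open>(2 - 2 * a) * (2 + 2 * a)\<close> with \<open>a\<close> the
  affinity, and \<open>a \<le> 1\<close>.\<close>

lemma affinity_le:
  fixes p q :: "'a \<Rightarrow> real"
  assumes "\<And>y. y \<in> B \<Longrightarrow> p y \<ge> 0" "\<And>y. y \<in> B \<Longrightarrow> q y \<ge> 0"
    and "sum p B = 1" "sum q B = 1"
  shows "(\<Sum>y\<in>B. sqrt (p y * q y)) \<le> 1 - (\<Sum>y\<in>B. \<bar>p y - q y\<bar>)\<^sup>2 / 8"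
proof -
  let ?a = "\<Sum>y\<in>B. sqrt (p y * q y)"
  have m: "(\<Sum>y\<in>B. (sqrt (p y) - sqrt (q y))\<^sup>2) = 2 - 2 * ?a"
  proof -
    have "(\<Sum>y\<in>B. (sqrt (p y) - sqrt (q y))\<^sup>2) = (\<Sum>y\<in>B. p y + q y - 2 * sqrt (p y * q y))"
      using assms by (intro sum.cong) (auto simp: power2_diff real_sqrt_mult)
    then show ?thesis using assms by (simp add: sum.distrib sum_subtractf sum_distrib_left)
  qed
  have pl: "(\<Sum>y\<in>B. (sqrt (p y) + sqrt (q y))\<^sup>2) = 2 + 2 * ?a"
  proof -
    have "(\<Sum>y\<in>B. (sqrt (p y) + sqrt (q y))\<^sup>2) = (\<Sum>y\<in>B. p y + q y + 2 * sqrt (p y * q y))"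
      using assms by (intro sum.cong) (auto simp: power2_sum real_sqrt_mult)
    then show ?thesis using assms by (simp add: sum.distrib sum_distrib_left)
  qed
  have a1: "2 - 2 * ?a \<ge> 0" unfolding m[symmetric] by (simp add: sum_nonneg)
  have "\<bar>p y - q y\<bar> = \<bar>sqrt (p y) - sqrt (q y)\<bar> * \<bar>sqrt (p y) + sqrt (q y)\<bar>" if "y \<in> B" for y
  proof -
    have "p y - q y = (sqrt (p y) - sqrt (q y)) * (sqrt (p y) + sqrt (q y))"
      using assms that by (simp add: algebra_simps)
    then show ?thesis by (simp only: abs_mult)
  qed
  then have "(\<Sum>y\<in>B. \<bar>p y - q y\<bar>)\<^sup>2 =
      (\<Sum>y\<in>B. \<bar>sqrt (p y) - sqrt (q y)\<bar> * \<bar>sqrt (p y) + sqrt (q y)\<bar>)\<^sup>2"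
    by simp
  also have "\<dots> \<le> (2 - 2 * ?a) * (2 + 2 * ?a)"
    unfolding m[symmetric] pl[symmetric]
    by (rule order_trans[OF Cauchy_Schwarz_ineq_sum]) (simp add: power2_abs)
  also have "\<dots> \<le> (2 - 2 * ?a) * 4" using a1 by (intro mult_left_mono) auto
  finally show ?thesis by simp
qed

subsection \<open>Blocks with random weights\<close>

text \<open>Take \<open>u x\<close> labelled copies of each \<open>x\<close>, choose a copy
  uniformly and forget its label.\<close>

lemma exists_weight_pmf:
  fixes u :: "'a \<Rightarrow> nat"
  assumes "finite R" "sum u R > 0"
  obtains p where "set_pmf p \<subseteq> R" "\<And>x. x \<in> R \<Longrightarrow> pmf p x = u x / sum u R"
proof
  let ?E = "SIGMA x:R. {..<u x}"
  let ?p = "map_pmf fst (pmf_of_set ?E)"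
  have E: "finite ?E" "card ?E = sum u R" using assms by auto
  then have ne: "?E \<noteq> {}" using assms by (metis card.empty less_irrefl)
  show "set_pmf ?p \<subseteq> R"
    unfolding set_map_pmf set_pmf_of_set[OF ne E(1)] by auto
  fix x assume x: "x \<in> R"
  have "?E \<inter> fst -` {x} = Pair x ` {..<u x}" using x by auto
  then have "card (?E \<inter> fst -` {x}) = u x" by (simp add: card_image inj_on_def)
  then show "pmf ?p x = u x / sum u R"
    using E ne by (simp add: pmf_map measure_pmf_of_set)
qed

definition sign_weight :: "'a set \<Rightarrow> 'a \<Rightarrow> nat" where
  "sign_weight A x = (if x \<in> A then 3 else 1)"

text \<open>For finite nonempty \<open>R\<close> such a \<open>pmf\<close> exists and is unique;
  otherwise the choice is unspecified.\<close>

definition sign_pmf :: "'a set \<Rightarrow> 'a set \<Rightarrow> 'a pmf" where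
  "sign_pmf R A = (SOME p. set_pmf p \<subseteq> R \<and>
     (\<forall>x\<in>R. pmf p x = sign_weight A x / sum (sign_weight A) R))"

lemma sum_sign_weight:
  "card R \<le> sum (sign_weight A) R" "sum (sign_weight A) R \<le> 3 * card R"
  using sum_bounded_below[of R 1 "sign_weight A"] sum_bounded_above[of R "sign_weight A" 3]
  by (simp_all add: sign_weight_def mult.commute)

context
  fixes R :: "'a set"
  assumes R: "finite R" "R \<noteq> {}"
begin

lemma sum_sign_weight_pos: "sum (sign_weight A) R > 0"
  using sum_sign_weight(1)[of R A] R card_gt_0_iff[of R] by linarith

lemma sign_pmf:
  shows set_sign_pmf: "set_pmf (sign_pmf R A) \<subseteq> R"
    and pmf_sign_pmf: "x \<in> R \<Longrightarrow> pmf (sign_pmf R A) x = sign_weight A x / sum (sign_weight A) R"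
proof -
  have "\<exists>p. set_pmf p \<subseteq> R \<and> (\<forall>x\<in>R. pmf p x = sign_weight A x / sum (sign_weight A) R)"
    using exists_weight_pmf[OF R(1) sum_sign_weight_pos] by metis
  from someI_ex[OF this] show "set_pmf (sign_pmf R A) \<subseteq> R"
    "x \<in> R \<Longrightarrow> pmf (sign_pmf R A) x = sign_weight A x / sum (sign_weight A) R"
    unfolding sign_pmf_def by auto
qed

text \<open>A weight is at most 3, so its square is at most 3 times the weight, while the total
  weight is at least \<open>card R\<close>.\<close>

lemma cp_sign_pmf: "cp (sign_pmf R A) \<le> 3 / card R"
proof -
  let ?n = "real (sum (sign_weight A) R)"
  have n: "?n > 0" "?n \<ge> card R" using sum_sign_weight_pos[of A] sum_sign_weight(1)[of R A]
    by (simp_all only: of_nat_0_less_iff of_nat_le_iff)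
  have "cp (sign_pmf R A) = (\<Sum>x\<in>R. (sign_weight A x / ?n)\<^sup>2)"
    using R by (simp add: cp_finite_support[OF _ set_sign_pmf] pmf_sign_pmf)
  also have "\<dots> \<le> (\<Sum>x\<in>R. 3 / ?n\<^sup>2 * sign_weight A x)"
    by (intro sum_mono) (auto simp: sign_weight_def power_divide divide_right_mono)
  also have "\<dots> = 3 / ?n"
    unfolding sum_distrib_left[symmetric] of_nat_sum[symmetric]
    using n by (simp add: power2_eq_square del: of_nat_sum)
  also have "\<dots> \<le> 3 / card R"
    using n R by (intro divide_left_mono) (auto simp: card_gt_0_iff)
  finally show ?thesis .
qed

lemma pmf_map_sign_pmf:
  "pmf (map_pmf h (sign_pmf R A)) y =
    (\<Sum>x\<in>R. if h x = y then real (sign_weight A x) else 0) / sum (sign_weight A) R"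
proof -
  have "pmf (map_pmf h (sign_pmf R A)) y = measure_pmf.prob (sign_pmf R A) {x\<in>R. h x = y}"
    unfolding pmf_map using set_sign_pmf[of A]
    by (intro measure_pmf.finite_measure_eq_AE) (auto simp: AE_measure_pmf_iff)
  also have "\<dots> = (\<Sum>x\<in>{x\<in>R. h x = y}. sign_weight A x / sum (sign_weight A) R)"
    using R by (simp add: measure_measure_pmf_finite pmf_sign_pmf)
  finally show ?thesis
    by (simp add: sum_divide_distrib[symmetric] sum.inter_filter[symmetric] R)
qed

text \<open>Up to the normalisation, which is at most \<open>3 * card R\<close>, the deviation from
  \<open>1 / M\<close> is a constant \<open>c\<close> plus a signed sum. If \<open>y\<close> has
  many preimages, the signed sum is large by Khintchine's inequality; if it has few,
  \<open>c\<close> itself is large.\<close>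

lemma sum_discrepancy_sign_pmf:
  fixes h :: "'a \<Rightarrow> nat"
  assumes M: "M \<ge> 2" "real M \<le> card R"
  shows "(\<Sum>A\<in>Pow R. \<bar>pmf (map_pmf h (sign_pmf R A)) y - 1 / M\<bar>) \<ge>
    2 ^ card R * (1 / (18 * sqrt (real M * card R)))"
proof -
  define r where "r = real (card R)"
  have r: "r > 0" "r \<ge> M" using R M by (simp_all add: r_def card_gt_0_iff)
  \<comment> \<open>Centring by \<open>1 / M\<close> absorbs the total weight, which varies with
    \<open>A\<close>. As the weights are 2 plus or minus 1, \<open>c\<close> below collects the
    constant part 2.\<close>
  define a where "a x = (if h x = y then 1 else 0) - 1 / real M" for x
  define ny where "ny = (\<Sum>x\<in>R. if h x = y then 1 else 0 :: real)"
  define c where "c = 2 * sum a R"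
  have c: "c = 2 * (ny - r / M)" by (simp add: c_def a_def ny_def r_def sum_subtractf)
  have ge: "\<bar>pmf (map_pmf h (sign_pmf R A)) y - 1 / M\<bar> \<ge> \<bar>c + signed_sum a R A\<bar> / (3 * r)" for A
  proof -
    let ?n = "real (sum (sign_weight A) R)"
    have n: "?n > 0" "?n \<le> 3 * r" using sum_sign_weight_pos[of A] sum_sign_weight(2)[of A R]
      unfolding r_def by linarith+
    have "pmf (map_pmf h (sign_pmf R A)) y - 1 / M =
        ((\<Sum>x\<in>R. if h x = y then real (sign_weight A x) else 0) - ?n / M) / ?n"
      using n by (simp add: pmf_map_sign_pmf diff_divide_distrib)
    also have "(\<Sum>x\<in>R. if h x = y then real (sign_weight A x) else 0) - ?n / M =
        (\<Sum>x\<in>R. sign_weight A x * a x)"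
      by (simp add: a_def right_diff_distrib sum_subtractf sum_divide_distrib of_nat_sum
          if_distrib[of "\<lambda>t. _ * t"] cong: if_cong)
    also have "\<dots> = c + signed_sum a R A"
      unfolding c_def signed_sum_def sum_distrib_left sum.distrib[symmetric]
      by (intro sum.cong) (auto simp: sign_weight_def)
    finally have "\<bar>pmf (map_pmf h (sign_pmf R A)) y - 1 / M\<bar> = \<bar>c + signed_sum a R A\<bar> / ?n"
      using n by simp
    then show ?thesis using n r by (simp only:) (intro divide_left_mono, auto)
  qed
  define q where "q = sqrt (r / M)"
  have q2: "q\<^sup>2 = r / M" and q1: "q \<ge> 1" using r M by (simp_all add: q_def)
  have "(\<Sum>A\<in>Pow R. \<bar>c + signed_sum a R A\<bar>) \<ge> 2 ^ card R * (q / 6)"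
  proof (cases "ny \<ge> r / (2 * M)")
    case True
    have "1 / real M \<le> 1 / 2" using M by (intro divide_left_mono) auto
    then have "(1 / 2)\<^sup>2 \<le> (1 - 1 / real M)\<^sup>2" by (intro power_mono) auto
    then have "ny / 4 \<le> (\<Sum>x\<in>R. (a x)\<^sup>2)"
      unfolding ny_def sum_divide_distrib by (intro sum_mono) (auto simp: a_def power2_eq_square)
    moreover have "q\<^sup>2 / 8 \<le> ny / 4" using True unfolding q2 by simp
    \<comment> \<open>The factor \<open>3 / 10\<close> is chosen so that its product with the
      Khintchine constant \<open>5 / 9\<close> is \<open>1 / 6\<close>.\<close>
    moreover have "(3 / 10 * q)\<^sup>2 \<le> q\<^sup>2 / 8" by (simp add: power_mult_distrib power2_eq_square)
    ultimately have "(3 / 10 * q)\<^sup>2 \<le> (\<Sum>x\<in>R. (a x)\<^sup>2)" by linarith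
    then have "3 / 10 * q \<le> sqrt (\<Sum>x\<in>R. (a x)\<^sup>2)" by (rule real_le_rsqrt)
    then have "2 ^ card R * (q / 6) \<le> 2 ^ card R * (5 / 9 * sqrt (\<Sum>x\<in>R. (a x)\<^sup>2))"
      by (intro mult_left_mono) auto
    also note khintchine_lower[OF R(1), of a]
    also note sum_abs_signed_sum_shift(2)[OF R(1), of a c]
    finally show ?thesis .
  next
    case False
    then have "q\<^sup>2 \<le> \<bar>c\<bar>" unfolding c q2 by simp
    moreover have "q / 6 \<le> q\<^sup>2" using q1 by (simp add: power2_eq_square)
    ultimately have "2 ^ card R * (q / 6) \<le> 2 ^ card R * \<bar>c\<bar>"
      by (intro mult_left_mono) (linarith, simp)
    also note sum_abs_signed_sum_shift(1)[OF R(1), of c a]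
    finally show ?thesis .
  qed
  then have "2 ^ card R * (q / 6) / (3 * r) \<le> (\<Sum>A\<in>Pow R. \<bar>c + signed_sum a R A\<bar>) / (3 * r)"
    using r by (intro divide_right_mono) auto
  also have "\<dots> \<le> (\<Sum>A\<in>Pow R. \<bar>pmf (map_pmf h (sign_pmf R A)) y - 1 / M\<bar>)"
    unfolding sum_divide_distrib by (intro sum_mono ge)
  also have "2 ^ card R * (q / 6) / (3 * r) = 2 ^ card R * (1 / (18 * sqrt (M * r)))"
  proof -
    have "q / r = sqrt r / r / sqrt M" by (simp add: q_def real_sqrt_divide)
    then have "q / r = 1 / sqrt (M * r)"
      using r by (simp add: sqrt_divide_self_eq real_sqrt_mult inverse_eq_divide)
    moreover have "2 ^ card R * (q / 6) / (3 * r) = 2 ^ card R * (q / r / 18)" by simp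
    ultimately show ?thesis by simp
  qed
  finally show ?thesis by (simp add: r_def)
qed

text \<open>Summing the discrepancy over the \<open>M\<close> values shows that the mean of
  \<open>d A\<close> is at least \<beta>, and \<open>affinity_le\<close> turns this into a loss of
  \<open>\<beta>\<^sup>2 / 8\<close>, where \<open>2592 = 8 * 324\<close>.\<close>

lemma sum_affinity_sign_pmf:
  fixes h :: "'a \<Rightarrow> nat"
  assumes M: "M \<ge> 2" "real M \<le> card R" and h: "h \<in> R \<rightarrow> {1..M}"
  shows "(\<Sum>A\<in>Pow R. \<Sum>y\<in>{1..M}. sqrt (pmf (map_pmf h (sign_pmf R A)) y / M)) \<le>
    card (Pow R) * (1 - M / (2592 * card R))"
proof -
  define \<beta> where "\<beta> = sqrt (M / card R) / 18"
  define d where "d A = (\<Sum>y\<in>{1..M}. \<bar>pmf (map_pmf h (sign_pmf R A)) y - 1 / M\<bar>)" for A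
  have r: "real (card R) > 0" using R by (simp add: card_gt_0_iff)
  have \<beta>: "\<beta> \<ge> 0" "\<beta>\<^sup>2 = M / card R / 324" by (simp_all add: \<beta>_def power_divide)
  have "(\<Sum>A\<in>Pow R. d A) = (\<Sum>y\<in>{1..M}. \<Sum>A\<in>Pow R. \<bar>pmf (map_pmf h (sign_pmf R A)) y - 1 / M\<bar>)"
    unfolding d_def by (rule sum.swap)
  also have "\<dots> \<ge> (\<Sum>y\<in>{1..M}. 2 ^ card R * (1 / (18 * sqrt (real M * card R))))"
    by (intro sum_mono sum_discrepancy_sign_pmf M)
  also have "(\<Sum>y\<in>{1..M}. 2 ^ card R * (1 / (18 * sqrt (real M * card R)))) = 2 ^ card R * \<beta>"
    using M r by (simp add: \<beta>_def real_sqrt_mult real_sqrt_divide field_simps)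
  finally have sum_d: "(\<Sum>A\<in>Pow R. d A) \<ge> 2 ^ card R * \<beta>" .
  have aff: "(\<Sum>y\<in>{1..M}. sqrt (pmf (map_pmf h (sign_pmf R A)) y / M)) \<le> 1 - (2 * \<beta> * d A - \<beta>\<^sup>2) / 8" for A
  proof -
    have "set_pmf (map_pmf h (sign_pmf R A)) \<subseteq> {1..M}"
      using set_sign_pmf[of A] h by auto
    then have "(\<Sum>y\<in>{1..M}. pmf (map_pmf h (sign_pmf R A)) y) = 1"
      by (intro sum_pmf_eq_1) auto
    then have "(\<Sum>y\<in>{1..M}. sqrt (pmf (map_pmf h (sign_pmf R A)) y / M)) \<le> 1 - (d A)\<^sup>2 / 8"
      using affinity_le[of "{1..M}" "pmf (map_pmf h (sign_pmf R A))" "\<lambda>_. 1 / M"] M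
      by (simp add: d_def)
    \<comment> \<open>The tangent to the square at \<beta> stands in for Jensen's inequality: being
      linear in \<open>d A\<close>, it can be summed over \<open>A\<close>.\<close>
    moreover have "2 * \<beta> * d A - \<beta>\<^sup>2 \<le> (d A)\<^sup>2"
      using zero_le_power2[of "d A - \<beta>"] by (simp add: power2_diff mult.commute mult.left_commute)
    ultimately show ?thesis
      by (elim order_trans) (intro diff_left_mono divide_right_mono, simp_all)
  qed
  have "(\<Sum>A\<in>Pow R. \<Sum>y\<in>{1..M}. sqrt (pmf (map_pmf h (sign_pmf R A)) y / M)) \<le>
      (\<Sum>A\<in>Pow R. 1 - (2 * \<beta> * d A - \<beta>\<^sup>2) / 8)"
    by (intro sum_mono aff)
  also have "\<dots> = 2 ^ card R * (1 + \<beta>\<^sup>2 / 8) - \<beta> / 4 * (\<Sum>A\<in>Pow R. d A)"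
    using R by (simp add: sum_subtractf sum.distrib sum_divide_distrib[symmetric] diff_divide_distrib
        sum_distrib_left[symmetric] card_Pow algebra_simps)
  also have "\<dots> \<le> 2 ^ card R * (1 + \<beta>\<^sup>2 / 8) - \<beta> / 4 * (2 ^ card R * \<beta>)"
    using \<beta> sum_d by (intro diff_left_mono mult_left_mono) auto
  also have "\<dots> = 2 ^ card R * (1 - \<beta>\<^sup>2 / 8)"
    by (simp add: power2_eq_square algebra_simps)
  finally show ?thesis using R by (simp add: \<beta>(2) card_Pow)
qed

end

section \<open>Affinity of distributions with small support\<close>

lemma sum_sqrt_le_sqrt_card:
  fixes p :: "'a \<Rightarrow> real"
  assumes "\<And>y. y \<in> B \<Longrightarrow> p y \<ge> 0" "sum p B \<le> 1"
  shows "(\<Sum>y\<in>B. sqrt (p y)) \<le> sqrt (card B)"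
proof (rule real_le_rsqrt)
  have "(\<Sum>y\<in>B. 1 * sqrt (p y))\<^sup>2 \<le> (\<Sum>y\<in>B. 1\<^sup>2) * (\<Sum>y\<in>B. (sqrt (p y))\<^sup>2)"
    by (rule Cauchy_Schwarz_ineq_sum)
  also have "(\<Sum>y\<in>B. (sqrt (p y))\<^sup>2) = sum p B" using assms by (intro sum.cong) auto
  finally show "(\<Sum>y\<in>B. sqrt (p y))\<^sup>2 \<le> card B"
    using assms mult_left_mono[of "sum p B" 1 "real (card B)"] by simp
qed

text \<open>At most \<open>card R\<close> hash values carry mass, so Cauchy-Schwarz is applied to
  these alone.\<close>

lemma sum_affinity_le_sqrt_support:
  fixes h :: "'a \<Rightarrow> nat"
  assumes "finite R" "set_pmf p \<subseteq> R"
  shows "(\<Sum>y\<in>{1..M}. sqrt (pmf (map_pmf h p) y / M)) \<le> sqrt (card R / M)"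
proof -
  let ?q = "map_pmf h p" and ?B = "{1..M} \<inter> h ` R"
  have "(\<Sum>y\<in>{1..M}. sqrt (pmf ?q y / M)) = (\<Sum>y\<in>?B. sqrt (pmf ?q y / M))"
    using assms by (intro sum.mono_neutral_right) (auto simp: set_pmf_iff[symmetric] pmf_eq_0_set_pmf)
  also have "\<dots> = (\<Sum>y\<in>?B. sqrt (pmf ?q y)) / sqrt M"
    by (simp add: real_sqrt_divide sum_divide_distrib)
  also have "\<dots> \<le> sqrt (card R) / sqrt M"
  proof (rule divide_right_mono)
    have "(\<Sum>y\<in>?B. pmf ?q y) \<le> 1"
      using measure_measure_pmf_finite[of ?B ?q] by (metis finite_Int finite_atLeastAtMost measure_pmf.prob_le_1)
    then have "(\<Sum>y\<in>?B. sqrt (pmf ?q y)) \<le> sqrt (card ?B)"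
      by (intro sum_sqrt_le_sqrt_card) auto
    also have "card ?B \<le> card R"
      using assms(1) card_mono[of "h ` R" ?B] card_image_le[of R h] by auto
    finally show "(\<Sum>y\<in>?B. sqrt (pmf ?q y)) \<le> sqrt (card R)" by simp
  qed simp
  finally show ?thesis by (simp add: real_sqrt_divide)
qed

subsection \<open>The lower bound\<close>

text \<open>The upper bound on \<alpha> says that \<open>exp (- T / 32)\<close> is below
  \<open>\<delta> ^ 3 / (128 * \<alpha>)\<close>, and each factor \<open>sqrt (1 / 2)\<close> is at
  most \<open>exp (- 1 / 32)\<close>. This serves the case of small \<open>K\<close>.\<close>

lemma const_power_bound:
  fixes \<delta> \<alpha> :: real
  assumes \<delta>: "0 < \<delta>" "\<delta> < 1" and \<alpha>: "\<alpha> > 1" "\<alpha> < \<delta> ^ 3 * exp (real T / 32) / 128"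
  shows "sqrt (1 / 2) ^ T \<le> \<delta>\<^sup>2 / (4 * sqrt \<alpha>)"
proof -
  have "sqrt (1 / 2) \<le> exp (- (1 / 32))"
  proof (rule real_le_lsqrt)
    have "1 / 2 \<le> exp (- (1 / 16) :: real)"
      using exp_ge_add_one_self[of "- (1 / 16) :: real"] by linarith
    also have "exp (- (1 / 16) :: real) = (exp (- (1 / 32)))\<^sup>2"
      by (simp add: exp_of_nat_mult[symmetric])
    finally show "1 / 2 \<le> (exp (- (1 / 32)) :: real)\<^sup>2" .
  qed auto
  then have "sqrt (1 / 2) ^ T \<le> exp (- (1 / 32)) ^ T" by (intro power_mono) auto
  also have "\<dots> = 1 / exp (real T / 32)"
    by (simp add: exp_of_nat_mult[symmetric] exp_minus inverse_eq_divide power_one_over)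
  also have "\<dots> \<le> \<delta> ^ 3 / (128 * \<alpha>)"
    using \<alpha> by (simp add: field_simps)
  also have "\<dots> \<le> \<delta>\<^sup>2 / (4 * sqrt \<alpha>)"
  proof (rule frac_le)
    show "\<delta> ^ 3 \<le> \<delta>\<^sup>2" using \<delta> by (intro power_decreasing) auto
    have "sqrt \<alpha> \<le> \<alpha>" using \<alpha> by (intro real_le_lsqrt) (auto simp: power2_eq_square)
    then show "4 * sqrt \<alpha> \<le> 128 * \<alpha>" using \<alpha> by simp
  qed (use \<delta> \<alpha> in auto)
  finally show ?thesis .
qed

text \<open>Of the four factors \<open>exp L\<close>, two are bounded below by 2, thanks to the
  maximum with 1, and two by \<open>\<alpha> / \<delta>\<close>.\<close>

lemma exp_neg_max_ln_bound:
  fixes \<delta> \<alpha> :: real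
  assumes \<delta>: "0 < \<delta>" and \<alpha>: "\<alpha> > 1"
  shows "exp (- 4 * max 1 (ln (\<alpha> / \<delta>))) \<le> \<delta>\<^sup>2 / (4 * sqrt \<alpha>)"
proof -
  define L where "L = max 1 (ln (\<alpha> / \<delta>))"
  have "2 \<le> exp (1 :: real)" using exp_ge_add_one_self[of "1::real"] by simp
  also have "\<dots> \<le> exp L" by (simp add: L_def)
  finally have e2: "2 \<le> exp L" .
  have "\<alpha> / \<delta> = exp (ln (\<alpha> / \<delta>))" using \<delta> \<alpha> by simp
  also have "\<dots> \<le> exp L" unfolding L_def by (subst exp_le_cancel_iff) simp
  finally have e: "\<alpha> / \<delta> \<le> exp L" .
  have "sqrt \<alpha> \<le> \<alpha>\<^sup>2"
  proof (rule real_le_lsqrt)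
    show "\<alpha> \<le> (\<alpha>\<^sup>2)\<^sup>2" using \<alpha> self_le_power[of \<alpha> 4] by simp
  qed auto
  then have "4 * sqrt \<alpha> / \<delta>\<^sup>2 \<le> 2\<^sup>2 * (\<alpha> / \<delta>)\<^sup>2"
    by (simp add: power_divide divide_right_mono)
  also have "\<dots> \<le> (exp L)\<^sup>2 * (exp L)\<^sup>2"
    using e e2 \<delta> \<alpha> by (intro mult_mono power_mono) auto
  also have "\<dots> = exp (4 * L)" by (simp add: exp_of_nat_mult[symmetric] exp_add[symmetric])
  finally have "1 / exp (4 * L) \<le> 1 / (4 * sqrt \<alpha> / \<delta>\<^sup>2)"
    using \<delta> \<alpha> by (intro divide_left_mono) auto
  then show ?thesis by (simp add: exp_minus inverse_eq_divide L_def)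
qed

theorem theorem4p4:
  "\<exists>c::real. c > 0 \<and>
     (\<forall>(N::nat) (M::nat) (T::nat) (\<delta>::real) (\<alpha>::real) (\<H>::(nat \<Rightarrow> nat) multiset).
        N > 0 \<longrightarrow> M \<ge> 2 \<longrightarrow> T > 0 \<longrightarrow> N \<ge> M * T \<longrightarrow>
        0 < \<delta> \<longrightarrow> \<delta> < 1 \<longrightarrow> \<alpha> > 1 \<longrightarrow> \<alpha> < \<delta> ^ 3 * exp (real T / 32) / 128 \<longrightarrow>
        hash_family N M \<H> \<longrightarrow>
        (\<exists>(K::nat) (X::nat list pmf).
           real K \<ge> c * \<delta>\<^sup>2 * real M * real T / max 1 (ln (\<alpha> / \<delta>)) \<and>
           block_source K N T X \<and>
           (\<forall>Q. set_pmf Q \<subseteq> members \<H> \<times> tuples M T \<longrightarrow>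
                cp Q \<le> \<alpha> / (real (size \<H>) * real M ^ T) \<longrightarrow>
                far (1 - \<delta>) (hashed \<H> X) Q)))"
proof (intro exI[of _ "1 / 100000"] conjI allI impI)
  fix N M T :: nat and \<delta> \<alpha> :: real and \<H> :: "(nat \<Rightarrow> nat) multiset"
  assume M: "M \<ge> 2" and T: "T > 0" and N: "N \<ge> M * T"
    and \<delta>: "0 < \<delta>" "\<delta> < 1" and \<alpha>: "\<alpha> > 1" "\<alpha> < \<delta> ^ 3 * exp (real T / 32) / 128"
    and \<H>: "hash_family N M \<H>"
  define L where "L = max 1 (ln (\<alpha> / \<delta>))"
  \<comment> \<open>The constant leaves room for \<open>31104 * K * L \<le> M * T\<close> with
    \<open>K \<le> 2 * k\<close>, which needs \<open>2 * 31104 \<le> 100000\<close>.\<close>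
  define k where "k = 1 / 100000 * \<delta>\<^sup>2 * real M * real T / L"
  define K where "K = nat \<lceil>k\<rceil>"
  have L: "L \<ge> 1" by (simp add: L_def)
  have k: "k > 0" using M T \<delta> L by (simp add: k_def)
  have K: "real K \<ge> k" "real K < k + 1" "K \<ge> 1"
    using k by (auto simp: K_def) linarith+
  have kL: "k * L \<le> real M * real T / 100000"
  proof -
    have "\<delta>\<^sup>2 \<le> 1" using \<delta> by (simp add: power_le_one)
    then have "\<delta>\<^sup>2 * (real M * real T) \<le> 1 * (real M * real T)" by (intro mult_right_mono) auto
    then show ?thesis using L by (simp add: k_def)
  qed
  have "\<exists>X. block_source K N T X \<and>
    (\<forall>Q. set_pmf Q \<subseteq> members \<H> \<times> tuples M T \<longrightarrow>
      cp Q \<le> \<alpha> / (real (size \<H>) * real M ^ T) \<longrightarrow> far (1 - \<delta>) (hashed \<H> X) Q)"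
  proof (cases "real K \<le> M / 2")
    case True
    let ?p = "pmf_of_set {1..K}"
    have "M * 1 \<le> M * T" using T by (intro mult_le_mono) auto
    then have KN: "K \<le> N" using True N by linarith
    have p: "set_pmf ?p = {1..K}" using K by (simp add: set_pmf_of_set)
    \<comment> \<open>All blocks have the same law, so the index set of candidates is a singleton;
      at most half of the hash values are hit, whence the affinity \<open>sqrt (1 / 2)\<close> per
      block.\<close>
    show ?thesis
    proof (rule exists_block_source[OF \<H>, where S = "{()}" and w = "\<lambda>_. ?p" and \<rho> = "sqrt (1 / 2)"])
      have "cp ?p = (\<Sum>x\<in>{1..K}. (pmf ?p x)\<^sup>2)"
        by (rule cp_finite_support[OF finite_atLeastAtMost equalityD1[OF p]])
      also have "\<dots> = (\<Sum>x\<in>{1..K}. (1 / real K)\<^sup>2)"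
        using K by (intro sum.cong) auto
      also have "\<dots> = 1 / real K" using K by (simp add: power2_eq_square)
      finally show "cp ?p \<le> 1 / real K" by simp
      show "set_pmf ?p \<subseteq> {1..N}" unfolding p using KN by simp
      fix h
      have "(\<Sum>y\<in>{1..M}. sqrt (pmf (map_pmf h ?p) y / M)) \<le> sqrt (card {1..K} / M)"
        by (rule sum_affinity_le_sqrt_support[OF finite_atLeastAtMost equalityD1[OF p]])
      also have "\<dots> \<le> sqrt (1 / 2)"
        using True M by (simp add: field_simps)
      finally show "(\<Sum>s\<in>{()}. \<Sum>y\<in>{1..M}. sqrt (pmf (map_pmf h ?p) y / M)) \<le>
          card {()} * sqrt (1 / 2)" by simp
    qed (use M \<delta> \<alpha> const_power_bound in auto)
  next
    case False
    \<comment> \<open>From 2 on, rounding \<open>k\<close> up to \<open>K\<close> at most doubles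
      it.\<close>
    then have "K \<ge> 2" using M by linarith
    then have K2: "real K \<le> 2 * k" using K by linarith
    \<comment> \<open>The factor 3 compensates the loss in \<open>cp_sign_pmf\<close>. These points
      fit into \<open>{1..N}\<close> because \<open>N \<ge> M * T\<close>, and there are at least
      \<open>M\<close> of them because \<open>K > M / 2\<close>.\<close>
    define R where "R = {1..3 * K}"
    have R: "finite R" "R \<noteq> {}" "card R = 3 * K" using K by (auto simp: R_def)
    have "k * 1 \<le> k * L" using k L by (intro mult_left_mono) auto
    then have "real (3 * K) \<le> real M * real T" using K2 kL by simp
    then have "3 * K \<le> M * T" by (simp only: of_nat_mult[symmetric] of_nat_le_iff)
    then have RN: "R \<subseteq> {1..N}" using N by (auto simp: R_def)
    define \<rho> where "\<rho> = 1 - M / (2592 * card R)"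
    show ?thesis
    proof (rule exists_block_source[OF \<H>, where S = "Pow R" and w = "sign_pmf R" and \<rho> = \<rho>])
      show "cp (sign_pmf R A) \<le> 1 / real K" for A
        using cp_sign_pmf[OF R(1,2), of A] K by (simp add: R)
      show "(\<Sum>A\<in>Pow R. \<Sum>y\<in>{1..M}. sqrt (pmf (map_pmf h (sign_pmf R A)) y / M)) \<le> card (Pow R) * \<rho>"
        if "h \<in> {1..N} \<rightarrow> {1..M}" for h
        unfolding \<rho>_def using that RN False M
        by (intro sum_affinity_sign_pmf R) (auto simp: R(3))
      have "\<rho> \<ge> 0" using False K by (simp add: \<rho>_def R field_simps)
      moreover have "\<rho> \<le> exp (- (M / (7776 * K)))"
        using exp_ge_add_one_self[of "- (M / (7776 * real K))"] by (simp add: \<rho>_def R)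
      ultimately have "\<rho> ^ T \<le> exp (- (M / (7776 * K))) ^ T" by (intro power_mono)
      also have "\<dots> = exp (- (M * T / (7776 * K)))"
        by (simp add: exp_of_nat_mult[symmetric] mult.commute)
      also have "\<dots> \<le> exp (- 4 * L)"
      proof -
        have "real K * L \<le> 2 * k * L" using K2 L by (intro mult_right_mono) auto
        also have "\<dots> \<le> 2 * (real M * real T / 100000)" using kL by simp
        \<comment> \<open>Here \<open>31104 = 4 * 7776\<close> and \<open>7776 = 3 * 2592\<close>,
          the 3 coming from \<open>card R = 3 * K\<close>.\<close>
        finally have "31104 * (real K * L) \<le> real M * real T"
          using mult_nonneg_nonneg[of "real M" "real T"] by linarith
        then have "4 * L \<le> M * T / (7776 * K)" using K by (simp add: field_simps)
        then show ?thesis by simp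
      qed
      also have "\<dots> \<le> \<delta>\<^sup>2 / (4 * sqrt \<alpha>)"
        unfolding L_def by (rule exp_neg_max_ln_bound[OF \<delta>(1) \<alpha>(1)])
      finally show "\<rho> ^ T \<le> \<delta>\<^sup>2 / (4 * sqrt \<alpha>)" .
    qed (use M \<delta> \<alpha> RN set_sign_pmf[OF R(1,2)] R in auto)
  qed
  then show "\<exists>K X. real K \<ge> 1 / 100000 * \<delta>\<^sup>2 * real M * real T / max 1 (ln (\<alpha> / \<delta>)) \<and>
      block_source K N T X \<and>
      (\<forall>Q. set_pmf Q \<subseteq> members \<H> \<times> tuples M T \<longrightarrow>
        cp Q \<le> \<alpha> / (real (size \<H>) * real M ^ T) \<longrightarrow> far (1 - \<delta>) (hashed \<H> X) Q)"
    using K(1) unfolding k_def L_def by blast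
qed simp

end
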